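(* Let $\{P_{u,b}\}$ be the local Pauli family on $\mathcal H=(\mathbb C^2)^{\otimes n}$, let $O=|\psi\rangle\langle\psi|$ with $|\psi\rangle\in\mathcal H$ a unit vector, let $F(\rho)=\operatorname{tr}(\rho O)$, and let $N\ge1$ be an integer. Let $\widehat F_N$ be the output of the spectral minimax direct fidelity estimation algorithm with target $O$ and shot budget $N$. Then for every density operator $\rho$ on $\mathcal H$, $$\mathbb E_\rho[\widehat F_N]=F(\rho),$$ and $$\sup_{\rho}\mathbb E_\rho\!\left[(\widehat F_N-F(\rho))^2\right]\le\frac{\Gamma^\star(O)}{N},$$ the supremum being over all density operators on $\mathcal H$.
   Context: $\mathcal H=(\mathbb C^2)^{\otimes n}$ is the $n$-qubit Hilbert space. A density operator (state) is an operator $\rho\succeq0$ on $\mathcal H$ with $\operatorname{tr}(\rho)=1$. $A\preceq B$ means $B-A\succeq0$. Local Pauli family: settings are $u=(u_1,\dots,u_n)\in\mathcal U=\{X,Y,Z\}^n$ and outcomes are $b\in B_u=\{0,1\}^n$. With $H$ the Hadamard matrix and $S=\operatorname{diag}(1,i)$, set $U_Z=I$, $U_X=H$, $U_Y=HS^\dagger$, $U_u=U_{u_1}\otimes\cdots\otimes U_{u_n}$, and $P_{u,b}=U_u^\dagger|b\rangle\langle b|U_u$. For each $u$, $\sum_bP_{u,b}=I$. An admissible pair $(q,\alpha)$ for $O$ consists of a probability distribution $q$ on $\mathcal U$ and real numbers $\alpha_{u,b}$ such that $\alpha_{u,b}=0$ for all $b$ whenever $q(u)=0$, and $\sum_{u,b}\alpha_{u,b}P_{u,b}=O$.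 The corresponding one-shot estimator: when the state is $\rho$, sample $u$ from $q$, obtain outcome $b$ with probability $\operatorname{tr}(\rho P_{u,b})$, and output $X=\alpha_{u,b}/q(u)$; $\operatorname{Var}_\rho(X)$ is its variance. Define $$\Gamma^\star(O)=\inf_{(q,\alpha)\ \text{admissible}}\ \sup_\rho\operatorname{Var}_\rho(X).$$ Spectral minimax direct fidelity estimation algorithm. Offline: take any optimal solution $(\alpha^\star,q^\star,y^\star,t^\star,\gamma^\star,s^\star)$ of the semidefinite program, in real variables, minimizing $\gamma+s$ subject to $\sum_{u,b}\alpha_{u,b}P_{u,b}=O$; $q(u)\ge0$ for all $u$ and $\sum_uq(u)=1$; $\begin{bmatrix}y_{u,b}&\alpha_{u,b}\\ \alpha_{u,b}&q(u)\end{bmatrix}\succeq0$ for all $u,b$; $\sum_{u,b}y_{u,b}P_{u,b}-2tO\preceq\gamma I$; $\begin{bmatrix}s&t\\t&1\end{bmatrix}\succeq0$. Online: for $j=1,\dots,N$ independently, sample $u_j$ from $q^\star$, measure a fresh copy of $\rho$ with $\{P_{u_j,b}\}_b$ to get $b_j$ (with probability $\operatorname{tr}(\rho P_{u_j,b_j})$), and set $X_j=\alpha^\star_{u_j,b_j}/q^\star(u_j)$. Output $\widehat F_N=\frac1N\sum_{j=1}^NX_j$. $\mathbb E_\rho$ denotes expectation over this online procedure. *)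

theory Defs
  imports "HOL-Probability.Probability"
begin

section \<open>Operators\<close>

definition dagger :: "complex^'a^'b \<Rightarrow> complex^'b^'a" where
  "dagger A = (\<chi> i j. cnj (A $ j $ i))"

definition cinner :: "complex^'a \<Rightarrow> complex^'a \<Rightarrow> complex" where
  "cinner v w = (\<Sum>i\<in>UNIV. cnj (v $ i) * w $ i)"

definition psd :: "complex^'a^'a \<Rightarrow> bool" where
  "psd A \<longleftrightarrow> dagger A = A \<and> (\<forall>v. 0 \<le> Re (cinner v (A *v v)))"

definition loewner_le :: "complex^'a^'a \<Rightarrow> complex^'a^'a \<Rightarrow> bool"  (infix "\<preceq>" 50) where
  "A \<preceq> B \<longleftrightarrow> psd (B - A)"

definition ketbra :: "complex^'a \<Rightarrow> complex^'a^'a" where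
  "ketbra v = (\<chi> i j. v $ i * cnj (v $ j))"

definition density_op :: "complex^'a^'a \<Rightarrow> bool" where
  "density_op \<rho> \<longleftrightarrow> psd \<rho> \<and> trace \<rho> = 1"

text \<open>The expectation value of a Hermitian operator; the trace is then real, see
  \<open>trace_eq_expval\<close> below.\<close>

definition expval :: "complex^'a^'a \<Rightarrow> complex^'a^'a \<Rightarrow> real" where
  "expval \<rho> A = Re (trace (\<rho> ** A))"

section \<open>The local Pauli family\<close>

text \<open>The qubits are indexed by an arbitrary finite type \<open>'n\<close>, so their number is \<open>CARD('n)\<close>.
  The computational basis of the \<open>n\<close>-fold tensor power of the single-qubit space is indexed by
  bit strings \<open>'n \<Rightarrow> bool\<close>, where \<open>False\<close> stands for \<open>0\<close> and \<open>True\<close> for \<open>1\<close>; in this basis the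
  entries of a tensor product are the products of the entries of its factors.\<close>

type_synonym 'n bits = "'n \<Rightarrow> bool"
type_synonym 'n state = "complex ^ ('n \<Rightarrow> bool)"
type_synonym 'n oper = "complex ^ ('n \<Rightarrow> bool) ^ ('n \<Rightarrow> bool)"

datatype pauli = PauliX | PauliY | PauliZ

lemma UNIV_pauli: "(UNIV :: pauli set) = {PauliX, PauliY, PauliZ}"
  using pauli.exhaust by auto

instance pauli :: finite
  by standard (simp add: UNIV_pauli)

type_synonym 'n setting = "'n \<Rightarrow> pauli"

definition mat2 :: "complex \<Rightarrow> complex \<Rightarrow> complex \<Rightarrow> complex \<Rightarrow> complex^bool^bool" where
  "mat2 a b c d = (\<chi> i j. if i then (if j then d else c) else (if j then b else a))"

definition hadamard :: "complex^bool^bool" where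
  "hadamard = (1 / sqrt 2) *\<^sub>R mat2 1 1 1 (-1)"

definition phase_gate :: "complex^bool^bool" where
  "phase_gate = mat2 1 0 0 \<i>"

fun basis_change :: "pauli \<Rightarrow> complex^bool^bool" where
  "basis_change PauliZ = mat 1"
| "basis_change PauliX = hadamard"
| "basis_change PauliY = hadamard ** dagger phase_gate"

definition tensor :: "('n::finite \<Rightarrow> complex^bool^bool) \<Rightarrow> 'n oper" where
  "tensor A = (\<chi> x y. \<Prod>k\<in>UNIV. A k $ x k $ y k)"

definition setting_unitary :: "'n::finite setting \<Rightarrow> 'n oper" where
  "setting_unitary u = tensor (\<lambda>k. basis_change (u k))"

definition pauli_proj :: "'n::finite setting \<Rightarrow> 'n bits \<Rightarrow> 'n oper" where
  "pauli_proj u b = dagger (setting_unitary u) ** ketbra (axis b 1) ** setting_unitary u"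

section \<open>Admissible pairs and one-shot estimators\<close>

definition distribution :: "('n::finite setting \<Rightarrow> real) \<Rightarrow> bool" where
  "distribution q \<longleftrightarrow> (\<forall>u. 0 \<le> q u) \<and> (\<Sum>u\<in>UNIV. q u) = 1"

definition decomposes :: "'n::finite oper \<Rightarrow> ('n setting \<Rightarrow> 'n bits \<Rightarrow> real) \<Rightarrow> bool" where
  "decomposes Op \<alpha> \<longleftrightarrow> (\<Sum>u\<in>UNIV. \<Sum>b\<in>UNIV. \<alpha> u b *\<^sub>R pauli_proj u b) = Op"

definition admissible ::
  "'n::finite oper \<Rightarrow> ('n setting \<Rightarrow> real) \<Rightarrow> ('n setting \<Rightarrow> 'n bits \<Rightarrow> real) \<Rightarrow> bool" where
  "admissible Op q \<alpha> \<longleftrightarrow>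
     distribution q \<and> (\<forall>u. q u = 0 \<longrightarrow> (\<forall>b. \<alpha> u b = 0)) \<and> decomposes Op \<alpha>"

definition shot_pmf ::
  "('n::finite setting \<Rightarrow> real) \<Rightarrow> 'n oper \<Rightarrow> ('n setting \<times> 'n bits) pmf" where
  "shot_pmf q \<rho> =
     do {
       u \<leftarrow> embed_pmf q;
       b \<leftarrow> embed_pmf (\<lambda>b. expval \<rho> (pauli_proj u b));
       return_pmf (u, b)
     }"

definition one_shot ::
  "('n setting \<Rightarrow> 'n bits \<Rightarrow> real) \<Rightarrow> ('n setting \<Rightarrow> real) \<Rightarrow> 'n setting \<times> 'n bits \<Rightarrow> real" where
  "one_shot \<alpha> q = (\<lambda>(u, b). \<alpha> u b / q u)"

text \<open>The extremal values are taken in the extended reals, where they always exist.\<close>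

definition minimax_var :: "'n::finite oper \<Rightarrow> ereal" where
  "minimax_var Op =
     (INF (q, \<alpha>) \<in> {(q, \<alpha>). admissible Op q \<alpha>}.
        SUP \<rho> \<in> Collect density_op.
          ereal (measure_pmf.variance (shot_pmf q \<rho>) (one_shot \<alpha> q)))"

section \<open>The estimation algorithm\<close>

definition sdp_feasible ::
  "'n::finite oper \<Rightarrow> ('n setting \<Rightarrow> 'n bits \<Rightarrow> real) \<Rightarrow> ('n setting \<Rightarrow> real) \<Rightarrow>
   ('n setting \<Rightarrow> 'n bits \<Rightarrow> real) \<Rightarrow> real \<Rightarrow> real \<Rightarrow> real \<Rightarrow> bool" where
  "sdp_feasible Op \<alpha> q y t \<gamma> s \<longleftrightarrow>
     decomposes Op \<alpha> \<and>
     distribution q \<and>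
     (\<forall>u b. psd (mat2 (of_real (y u b)) (of_real (\<alpha> u b)) (of_real (\<alpha> u b)) (of_real (q u)))) \<and>
     (\<Sum>u\<in>UNIV. \<Sum>b\<in>UNIV. y u b *\<^sub>R pauli_proj u b) - (2 * t) *\<^sub>R Op \<preceq> \<gamma> *\<^sub>R mat 1 \<and>
     psd (mat2 (of_real s) (of_real t) (of_real t) 1)"

definition sdp_optimal ::
  "'n::finite oper \<Rightarrow> ('n setting \<Rightarrow> 'n bits \<Rightarrow> real) \<Rightarrow> ('n setting \<Rightarrow> real) \<Rightarrow>
   ('n setting \<Rightarrow> 'n bits \<Rightarrow> real) \<Rightarrow> real \<Rightarrow> real \<Rightarrow> real \<Rightarrow> bool" where
  "sdp_optimal Op \<alpha> q y t \<gamma> s \<longleftrightarrow>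
     sdp_feasible Op \<alpha> q y t \<gamma> s \<and>
     (\<forall>\<alpha>' q' y' t' \<gamma>' s'. sdp_feasible Op \<alpha>' q' y' t' \<gamma>' s' \<longrightarrow> \<gamma> + s \<le> \<gamma>' + s')"

definition online_pmf ::
  "nat \<Rightarrow> ('n::finite setting \<Rightarrow> real) \<Rightarrow> 'n oper \<Rightarrow> (nat \<Rightarrow> 'n setting \<times> 'n bits) pmf" where
  "online_pmf N q \<rho> = Pi_pmf {..<N} undefined (\<lambda>_. shot_pmf q \<rho>)"

definition fidelity_estimate ::
  "nat \<Rightarrow> ('n setting \<Rightarrow> 'n bits \<Rightarrow> real) \<Rightarrow> ('n setting \<Rightarrow> real) \<Rightarrow>
   (nat \<Rightarrow> 'n setting \<times> 'n bits) \<Rightarrow> real" where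
  "fidelity_estimate N \<alpha> q \<omega> = (\<Sum>j<N. one_shot \<alpha> q (\<omega> j)) / real N"

section \<open>The measurement model is well-defined\<close>

lemma dagger_mult: "dagger (A ** B) = dagger B ** dagger A"
  by (simp add: dagger_def matrix_matrix_mult_def vec_eq_iff mult.commute)

lemma dagger_dagger [simp]: "dagger (dagger A) = A"
  by (simp add: dagger_def vec_eq_iff)

lemma trace_dagger: "trace (dagger A) = cnj (trace A)"
  by (simp add: trace_def dagger_def)

lemma trace_eq_expval:
  assumes "dagger \<rho> = \<rho>" "dagger A = A"
  shows "trace (\<rho> ** A) = complex_of_real (expval \<rho> A)"
proof -
  have "cnj (trace (\<rho> ** A)) = trace (A ** \<rho>)"
    using assms by (metis trace_dagger dagger_mult)
  also have "\<dots> = trace (\<rho> ** A)"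
    by (rule trace_mul_sym)
  finally have "Im (trace (\<rho> ** A)) = 0"
    by (simp add: complex_eq_iff)
  then show ?thesis
    by (simp add: expval_def complex_eq_iff)
qed

lemma hadamard_unitary: "dagger hadamard ** hadamard = mat 1"
proof -
  have "complex_of_real (1 / sqrt 2) * complex_of_real (1 / sqrt 2) = 1 / 2"
    by (simp flip: of_real_mult)
  then show ?thesis
    by (auto simp: vec_eq_iff matrix_matrix_mult_def dagger_def hadamard_def mat2_def mat_def
        UNIV_bool scaleR_conv_of_real[where 'a = complex] mult_ac simp del: of_real_divide)
qed

lemma phase_gate_unitary: "phase_gate ** dagger phase_gate = mat 1"
  by (simp add: vec_eq_iff matrix_matrix_mult_def dagger_def phase_gate_def mat2_def mat_def UNIV_bool)

lemma basis_change_unitary: "dagger (basis_change p) ** basis_change p = mat 1"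
proof (cases p)
  case PauliX
  then show ?thesis by (simp add: hadamard_unitary)
next
  case PauliY
  have "dagger (basis_change p) ** basis_change p =
      phase_gate ** (dagger hadamard ** hadamard) ** dagger phase_gate"
    by (simp add: PauliY dagger_mult matrix_mul_assoc)
  then show ?thesis by (simp add: hadamard_unitary phase_gate_unitary)
next
  case PauliZ
  have "dagger (mat 1 :: complex^bool^bool) = mat 1"
    by (simp add: vec_eq_iff dagger_def mat_def)
  then show ?thesis by (simp add: PauliZ)
qed

lemma setting_unitary_unitary:
  fixes u :: "'n::finite setting"
  shows "dagger (setting_unitary u) ** setting_unitary u = mat 1"
proof -
  have "(\<Sum>b\<in>UNIV. cnj (\<Prod>k\<in>UNIV. basis_change (u k) $ b k $ x k)
            * (\<Prod>k\<in>UNIV. basis_change (u k) $ b k $ y k)) = (if x = y then 1 else 0)"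
    for x y :: "'n bits"
  proof -
    let ?f = "\<lambda>k c. cnj (basis_change (u k) $ c $ x k) * basis_change (u k) $ c $ y k"
    have col: "(\<Sum>c\<in>UNIV. ?f k c) = (if x k = y k then 1 else 0)" for k
      using arg_cong[OF basis_change_unitary[of "u k"], of "\<lambda>M. M $ x k $ y k"]
      by (simp add: matrix_matrix_mult_def dagger_def mat_def)
    have "(\<Sum>b\<in>UNIV. \<Prod>k\<in>UNIV. ?f k (b k)) = (\<Prod>k\<in>UNIV. \<Sum>c\<in>UNIV. ?f k c)"
      using prod_sum_PiE[of "UNIV :: 'n set" "\<lambda>_. UNIV" ?f] by (simp add: PiE_UNIV_domain)
    also have "\<dots> = (if x = y then 1 else 0)"
      by (auto simp: col fun_eq_iff)
    finally show ?thesis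
      by (simp add: prod.distrib)
  qed
  then show ?thesis
    by (simp add: vec_eq_iff matrix_matrix_mult_def dagger_def setting_unitary_def tensor_def mat_def)
qed

lemma pauli_proj_nth:
  "pauli_proj u b $ i $ j = cnj (setting_unitary u $ b $ i) * setting_unitary u $ b $ j"
proof -
  have ket: "ketbra (axis b 1) $ k $ l = (if k = b then if l = b then 1 else 0 else 0)" for k l
    by (simp add: ketbra_def axis_def)
  have left: "(\<Sum>k\<in>UNIV. cnj (setting_unitary u $ k $ i) * ketbra (axis b 1) $ k $ l) =
      (if l = b then cnj (setting_unitary u $ b $ i) else 0)" for l
    by (simp add: ket if_distrib[where f = "\<lambda>x. _ * x"] cong: if_cong)
  show ?thesis
    by (simp add: pauli_proj_def matrix_matrix_mult_def dagger_def left
        if_distrib[where f = "\<lambda>x. x * _"] cong: if_cong)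
qed

lemma pauli_proj_sum: "(\<Sum>b\<in>UNIV. pauli_proj u b) = mat 1"
  using setting_unitary_unitary[of u]
  by (simp add: vec_eq_iff pauli_proj_nth matrix_matrix_mult_def dagger_def)

lemma dagger_pauli_proj: "dagger (pauli_proj u b) = pauli_proj u b"
  by (simp add: vec_eq_iff dagger_def pauli_proj_nth mult.commute)

lemma expval_pauli_proj_nonneg:
  assumes "density_op \<rho>"
  shows "0 \<le> expval \<rho> (pauli_proj u b)"
proof -
  define v where "v = (\<chi> i. cnj (setting_unitary u $ b $ i))"
  have "trace (\<rho> ** pauli_proj u b) = cinner v (\<rho> *v v)"
    by (simp add: trace_def matrix_matrix_mult_def cinner_def matrix_vector_mult_def v_def
        pauli_proj_nth sum_distrib_left mult_ac)
  then show ?thesis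
    using assms by (simp add: expval_def density_op_def psd_def)
qed

lemma linear_expval: "linear (expval \<rho>)"
proof (rule linearI)
  show "expval \<rho> (A + B) = expval \<rho> A + expval \<rho> B" for A B
    by (simp add: expval_def matrix_add_ldistrib trace_add)
  show "expval \<rho> (c *\<^sub>R A) = c *\<^sub>R expval \<rho> A" for c A
  proof -
    have "\<rho> ** (c *\<^sub>R A) = c *\<^sub>R (\<rho> ** A)"
      by (simp add: vec_eq_iff matrix_matrix_mult_def scaleR_sum_right)
    then show ?thesis
      by (simp add: expval_def trace_def sum_distrib_left)
  qed
qed

lemma expval_pauli_proj_sum:
  assumes "density_op \<rho>"
  shows "(\<Sum>b\<in>UNIV. expval \<rho> (pauli_proj u b)) = 1"
proof -
  have "(\<Sum>b\<in>UNIV. expval \<rho> (pauli_proj u b)) = expval \<rho> (\<Sum>b\<in>UNIV. pauli_proj u b)"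
    by (simp add: linear_sum[OF linear_expval])
  then show ?thesis
    using assms by (simp add: pauli_proj_sum density_op_def expval_def)
qed

lemma pmf_embed_finite:
  fixes f :: "'a::finite \<Rightarrow> real"
  assumes "\<And>x. 0 \<le> f x" "(\<Sum>x\<in>UNIV. f x) = 1"
  shows "pmf (embed_pmf f) x = f x"
  using assms
  by (intro pmf_embed_pmf) (auto simp: nn_integral_count_space_finite)

lemma pmf_shot:
  assumes "distribution q" "density_op \<rho>"
  shows "pmf (shot_pmf q \<rho>) (u, b) = q u * expval \<rho> (pauli_proj u b)"
proof -
  have q: "pmf (embed_pmf q) u = q u" for u
    using assms(1) by (intro pmf_embed_finite) (auto simp: distribution_def)
  have p: "pmf (embed_pmf (\<lambda>b. expval \<rho> (pauli_proj u b))) b = expval \<rho> (pauli_proj u b)" for u b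
    using assms(2) by (intro pmf_embed_finite expval_pauli_proj_nonneg expval_pauli_proj_sum)
  have ind: "pmf (return_pmf (u', b')) (u, b) = (if u' = u then if b' = b then 1 else 0 else 0)"
    for u' b'
    by (auto simp: indicator_def)
  have inner: "(\<Sum>b'\<in>UNIV. expval \<rho> (pauli_proj u' b') * pmf (return_pmf (u', b')) (u, b)) =
      (if u' = u then expval \<rho> (pauli_proj u b) else 0)" for u'
    unfolding ind by (simp add: if_distrib[where f = "\<lambda>x. _ * x"] cong: if_cong)
  have "pmf (shot_pmf q \<rho>) (u, b) =
      (\<Sum>u'\<in>UNIV. q u' * (\<Sum>b'\<in>UNIV. expval \<rho> (pauli_proj u' b') * pmf (return_pmf (u', b')) (u, b)))"
    unfolding shot_pmf_def pmf_bind
    by (simp add: integral_measure_pmf_real[where A = UNIV] q p mult.commute del: pmf_return)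
  also have "\<dots> = q u * expval \<rho> (pauli_proj u b)"
    unfolding inner by (simp add: if_distrib[where f = "\<lambda>x. _ * x"] cong: if_cong)
  finally show ?thesis .
qed

end

theory Submission
  imports Defs
begin

text \<open>For a feasible point of the program and a state \<open>\<rho>\<close> with fidelity \<open>F\<close>, the variance of one
  shot is at most \<open>tr (\<rho> Y) - F\<^sup>2\<close> with \<open>Y = \<Sum> y P\<close>, and \<open>tr (\<rho> Y) - F\<^sup>2 \<le> \<gamma> + 2tF - F\<^sup>2 \<le> \<gamma> + t\<^sup>2\<close>, so
  the objective \<open>\<gamma> + s\<close> bounds the worst-case variance.
  Conversely, given an admissible pair, put \<open>y = \<alpha>\<^sup>2 / q\<close>. The variance \<open>tr (\<rho> Y) - F\<^sup>2\<close> is then a concave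
  function of the point \<open>(tr (\<rho> Y), F)\<close>, which ranges over a convex set, and the first-order condition
  at a (near-)maximizing state says that \<open>t =\<close> its fidelity makes \<open>(t, s = t\<^sup>2)\<close> feasible with objective
  (nearly) the worst-case variance. This replaces a minimax theorem. Using near-maximizers avoids
  proving that the set of states is compact.\<close>

section \<open>Positive semidefinite matrices\<close>

lemma cinner_add_right: "cinner u (v + w) = cinner u v + cinner u w"
  by (simp add: cinner_def distrib_left sum.distrib)

lemma cinner_diff_left: "cinner (u - v) w = cinner u w - cinner v w"
  by (simp add: cinner_def left_diff_distrib sum_subtractf)

lemma cinner_diff_right: "cinner u (v - w) = cinner u v - cinner u w"
  by (simp add: cinner_def right_diff_distrib sum_subtractf)

lemma cinner_scale_left: "cinner (c *s v) w = cnj c * cinner v w"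
  by (simp add: cinner_def sum_distrib_left mult_ac)

lemma cinner_scale_right: "cinner v (c *s w) = c * cinner v w"
  by (simp add: cinner_def sum_distrib_left mult_ac)

lemma cinner_commute: "cinner v w = cnj (cinner w v)"
  by (simp add: cinner_def mult.commute)

lemma cinner_dagger: "cinner v (A *v w) = cinner (dagger A *v v) w"
proof -
  have "cinner v (A *v w) = (\<Sum>i\<in>UNIV. \<Sum>j\<in>UNIV. cnj (v $ i) * A $ i $ j * w $ j)"
    by (simp add: cinner_def matrix_vector_mult_def sum_distrib_left mult_ac)
  also have "\<dots> = (\<Sum>j\<in>UNIV. \<Sum>i\<in>UNIV. cnj (v $ i) * A $ i $ j * w $ j)"
    by (rule sum.swap)
  also have "\<dots> = cinner (dagger A *v v) w"
    by (simp add: cinner_def matrix_vector_mult_def dagger_def sum_distrib_left mult_ac)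
  finally show ?thesis .
qed

lemma cinner_self: "cinner v v = of_real ((norm v)\<^sup>2)"
proof -
  have "cinner v v = of_real (\<Sum>i\<in>UNIV. (norm (v $ i))\<^sup>2)"
    unfolding cinner_def of_real_sum
    by (intro sum.cong refl) (simp only: complex_norm_square mult.commute)
  then show ?thesis
    by (simp add: norm_vec_def L2_set_def sum_nonneg)
qed

lemma matrix_vector_mult_axis: "(A *v axis j 1) $ i = A $ i $ j" for A :: "complex^'a^'b"
  by (simp add: matrix_vector_mult_def axis_def if_distrib[where f = "\<lambda>x. _ * x"] cong: if_cong)

lemma cinner_axis_matrix: "cinner (axis i 1) (A *v axis j 1) = A $ i $ j"
  by (simp add: cinner_def matrix_vector_mult_axis, simp add: axis_def if_distrib[where f = cnj] if_distrib[where f = "\<lambda>x. x * _"] cong: if_cong)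

lemma cinner_ketbra: "cinner v (ketbra w *v v) = of_real ((norm (cinner v w))\<^sup>2)"
proof -
  have "cinner v (ketbra w *v v) = cinner v w * cinner w v"
    by (simp add: cinner_def ketbra_def matrix_vector_mult_def sum_distrib_left sum_distrib_right mult_ac)
  then show ?thesis
    by (simp only: cinner_commute[of w v] complex_norm_square)
qed

lemma trace_ketbra_mult: "trace (ketbra w ** B) = cinner w (B *v w)"
proof -
  have "trace (ketbra w ** B) = (\<Sum>i\<in>UNIV. \<Sum>k\<in>UNIV. cnj (w $ k) * (B $ k $ i * w $ i))"
    by (simp add: trace_def matrix_matrix_mult_def ketbra_def mult_ac)
  also have "\<dots> = (\<Sum>k\<in>UNIV. \<Sum>i\<in>UNIV. cnj (w $ k) * (B $ k $ i * w $ i))"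
    by (rule sum.swap)
  also have "\<dots> = cinner w (B *v w)"
    by (simp add: cinner_def matrix_vector_mult_def sum_distrib_left)
  finally show ?thesis .
qed

lemma dagger_ketbra [simp]: "dagger (ketbra v) = ketbra v"
  by (simp add: dagger_def ketbra_def vec_eq_iff mult.commute)

lemma dagger_add: "dagger (A + B) = dagger A + dagger B"
  by (simp add: dagger_def vec_eq_iff)

lemma dagger_diff: "dagger (A - B) = dagger A - dagger B"
  by (simp add: dagger_def vec_eq_iff)

lemma dagger_scaleR: "dagger (c *\<^sub>R A) = c *\<^sub>R dagger A"
  by (simp add: dagger_def vec_eq_iff)

lemma dagger_sum: "dagger (\<Sum>x\<in>S. f x) = (\<Sum>x\<in>S. dagger (f x))"
  by (simp add: dagger_def vec_eq_iff)

lemma dagger_mat_1 [simp]: "dagger (mat 1) = mat 1"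
  by (simp add: dagger_def vec_eq_iff mat_def)

lemma scaleR_matrix_vector: "(c *\<^sub>R A) *v v = c *\<^sub>R (A *v v)" for A :: "complex^'a^'b"
  by (simp add: vec_eq_iff matrix_vector_mult_def scaleR_sum_right)

lemma cinner_scaleR_right: "cinner v (c *\<^sub>R w) = of_real c * cinner v w"
  by (simp add: cinner_def sum_distrib_left scaleR_conv_of_real[where 'a = complex] mult_ac)

section \<open>Positivity: Cauchy-Schwarz, principal minors, trace of a product\<close>

lemma psd_ketbra: "psd (ketbra v)"
  by (simp add: psd_def cinner_ketbra)

lemma psd_scaleR:
  assumes "psd A" "0 \<le> c"
  shows "psd (c *\<^sub>R A)"
  using assms by (simp add: psd_def dagger_scaleR scaleR_matrix_vector cinner_scaleR_right)

text \<open>The form of \<open>A\<close> is nonnegative at \<open>v - c *s w\<close>. Choosing the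
  phase of \<open>c\<close> to match \<open>cnj z\<close> makes the cross terms real, which leaves a
  real quadratic in \<open>r\<close> whose discriminant is the claim.\<close>

lemma psd_Cauchy_Schwarz:
  assumes "psd A"
  shows "(norm (cinner v (A *v w)))\<^sup>2 \<le> Re (cinner v (A *v v)) * Re (cinner w (A *v w))"
proof -
  define z where "z = cinner v (A *v w)"
  let ?Q = "\<lambda>x. Re (cinner x (A *v x))"
  have wv: "cinner w (A *v v) = cnj z"
    using assms by (metis cinner_commute cinner_dagger psd_def z_def)
  have key: "0 \<le> ?Q v + r\<^sup>2 * (norm z)\<^sup>2 * ?Q w - 2 * r * (norm z)\<^sup>2" for r :: real
  proof -
    define c where "c = of_real r * cnj z"
    have "cinner (v - c *s w) (A *v (v - c *s w)) =
        cinner v (A *v v) + cnj c * c * cinner w (A *v w) - c * z - cnj c * cnj z"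
      by (simp add: matrix_vector_mult_diff_distrib vector_scalar_commute cinner_diff_left
          cinner_diff_right cinner_scale_left cinner_scale_right wv flip: z_def)
         (simp add: algebra_simps)
    also have "\<dots> = cinner v (A *v v) + of_real (r\<^sup>2 * (norm z)\<^sup>2) * cinner w (A *v w)
        - of_real (2 * r * (norm z)\<^sup>2)"
      by (simp only: c_def of_real_mult complex_norm_square complex_cnj_mult
          complex_cnj_complex_of_real complex_cnj_cnj)
         (simp add: power2_eq_square algebra_simps)
    finally have "?Q (v - c *s w) = ?Q v + r\<^sup>2 * (norm z)\<^sup>2 * ?Q w - 2 * r * (norm z)\<^sup>2"
      by simp
    then show ?thesis
      using assms by (metis psd_def)
  qed
  have nn: "0 \<le> ?Q v" "0 \<le> ?Q w"
    using assms by (auto simp: psd_def)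
  show ?thesis
  proof (cases "?Q w = 0")
    case True
    have "z = 0"
    proof (rule ccontr)
      assume "z \<noteq> 0"
      then show False
        \<comment> \<open>The inequality is now linear in \<open>r\<close>; this value turns its
          right-hand side into -1.\<close>
        using key[of "(?Q v + 1) / (2 * (norm z)\<^sup>2)"] True by (simp add: field_simps)
    qed
    then show ?thesis
      using True by (simp flip: z_def)
  next
    case False
    with nn have "0 < ?Q w" by simp
    then show ?thesis
      \<comment> \<open>The minimizer of the quadratic in \<open>r\<close>.\<close>
      using key[of "1 / ?Q w"] by (simp add: field_simps power2_eq_square flip: z_def)
  qed
qed

lemma psd_diag:
  assumes "psd A"
  shows "0 \<le> Re (A $ i $ i)" "Im (A $ i $ i) = 0"
proof -
  show "0 \<le> Re (A $ i $ i)"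
    using assms cinner_axis_matrix[of i A i] by (metis psd_def)
  have "cnj (A $ i $ i) = A $ i $ i"
    using assms by (auto simp: psd_def dagger_def vec_eq_iff)
  then show "Im (A $ i $ i) = 0"
    by (simp add: complex_eq_iff)
qed

text \<open>Cauchy-Schwarz at two basis vectors. The main use is that a zero diagonal entry forces
  its whole row and column to vanish.\<close>

lemma psd_entry_bound:
  assumes "psd A"
  shows "(norm (A $ i $ j))\<^sup>2 \<le> Re (A $ i $ i) * Re (A $ j $ j)"
  using psd_Cauchy_Schwarz[OF assms, of "axis i 1" "axis j 1"] by (simp add: cinner_axis_matrix)

text \<open>One step of the Cholesky decomposition: subtracting a multiple of \<open>ketbra (column i A)\<close>
  annihilates the \<open>i\<close>-th row and column and creates no new nonzero diagonal entry.\<close>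

lemma trace_psd_mult_nonneg:
  assumes "psd A" "psd B"
  shows "0 \<le> Re (trace (A ** B))"
  using assms(1)
\<comment> \<open>Each rank-one piece split off from \<open>A\<close> contributes a nonnegative
  multiple of \<open>cinner w (B *v w)\<close> to the trace, and the remainder has fewer nonzero
  diagonal entries.\<close>
proof (induction "card {i. A $ i $ i \<noteq> 0}" arbitrary: A rule: less_induct)
  case less
  show ?case
  proof (cases "\<exists>i. A $ i $ i \<noteq> 0")
    case False
    then have "A = 0"
      using psd_entry_bound[OF less.prems] by (simp add: vec_eq_iff)
    then show ?thesis
      by (simp add: trace_def)
  next
    case True
    then obtain i where i: "A $ i $ i \<noteq> 0" by blast
    define a where "a = Re (A $ i $ i)"
    have Aii: "A $ i $ i = of_real a"
      using psd_diag[OF less.prems] by (simp add: a_def complex_eq_iff)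
    have a: "0 < a"
    proof -
      have "0 \<le> a"
        unfolding a_def using psd_diag(1)[OF less.prems] .
      with i Aii show ?thesis
        by (cases "a = 0") simp_all
    qed
    define w where "w = A *v axis i 1"
    have w: "w $ k = A $ k $ i" for k
      by (simp add: w_def matrix_vector_mult_axis)
    define A' where "A' = A - (1 / a) *\<^sub>R ketbra w"
    have "Re (cinner v (A' *v v)) = Re (cinner v (A *v v)) - (norm (cinner v w))\<^sup>2 / a" for v
      by (simp add: A'_def matrix_vector_mult_diff_rdistrib scaleR_matrix_vector cinner_diff_right
          cinner_scaleR_right cinner_ketbra)
    \<comment> \<open>Cauchy-Schwarz against the \<open>i\<close>-th basis vector: the subtracted
      form never exceeds that of \<open>A\<close>, so the remainder stays positive.\<close>
    moreover have "(norm (cinner v w))\<^sup>2 \<le> Re (cinner v (A *v v)) * a" for v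
      using psd_Cauchy_Schwarz[OF less.prems, of v "axis i 1"]
      by (simp add: cinner_axis_matrix a_def w_def)
    ultimately have psd': "psd A'"
      using less.prems a
      by (simp add: psd_def A'_def dagger_diff dagger_scaleR divide_le_eq)
    have A'ii: "A' $ i $ i = 0"
      using a by (simp add: A'_def ketbra_def w Aii scaleR_conv_of_real[where 'a = complex])
    have A'jj: "A' $ j $ j = 0" if "A $ j $ j = 0" for j
    proof -
      have "A $ j $ i = 0"
        using psd_entry_bound[OF less.prems, of j i] that by simp
      with that show ?thesis
        by (simp add: A'_def ketbra_def w)
    qed
    have "{j. A' $ j $ j \<noteq> 0} \<subset> {j. A $ j $ j \<noteq> 0}"
      using A'ii A'jj i by blast
    then have "card {j. A' $ j $ j \<noteq> 0} < card {j. A $ j $ j \<noteq> 0}"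
      by (intro psubset_card_mono) simp
    then have IH: "0 \<le> Re (trace (A' ** B))"
      using less.hyps psd' by blast
    have "trace (A ** B) = trace (A' ** B) + of_real (1 / a) * cinner w (B *v w)"
    proof -
      have "A ** B = A' ** B + (1 / a) *\<^sub>R (ketbra w ** B)"
        by (simp add: A'_def vec_eq_iff matrix_matrix_mult_def scaleR_sum_right
            algebra_simps sum_subtractf)
      moreover have "trace (c *\<^sub>R M) = of_real c * trace M" for c and M :: "complex^'a^'a"
        by (simp add: trace_def sum_distrib_left scaleR_conv_of_real[where 'a = complex])
      ultimately show ?thesis
        by (simp only: trace_add trace_ketbra_mult)
    qed
    then show ?thesis
      using IH a assms(2) by (simp add: psd_def)
  qed
qed

text \<open>Turns both kinds of 2x2 constraint in the program into scalar inequalities. For the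
  converse, the matrix is real, so the real and imaginary parts of a vector can be treated
  separately.\<close>

lemma psd_mat2_iff:
  "psd (mat2 (of_real a) (of_real b) (of_real b) (of_real c)) \<longleftrightarrow> 0 \<le> a \<and> 0 \<le> c \<and> b\<^sup>2 \<le> a * c"
  (is "psd ?M \<longleftrightarrow> _")
proof
  assume "psd ?M"
  from psd_diag(1)[OF this, of False] psd_diag(1)[OF this, of True] psd_entry_bound[OF this, of False True]
  show "0 \<le> a \<and> 0 \<le> c \<and> b\<^sup>2 \<le> a * c"
    by (simp add: mat2_def)
next
  assume *: "0 \<le> a \<and> 0 \<le> c \<and> b\<^sup>2 \<le> a * c"
  have real: "0 \<le> a * x\<^sup>2 + 2 * b * x * x' + c * x'\<^sup>2" for x x' :: real
  proof (cases "c = 0")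
    case True
    then show ?thesis using * by simp
  next
    case False
    \<comment> \<open>Completing the square after multiplication by \<open>c\<close>, which is
      positive here.\<close>
    have "0 \<le> (a * c - b\<^sup>2) * x\<^sup>2 + (b * x + c * x')\<^sup>2"
      using * by simp
    also have "\<dots> = c * (a * x\<^sup>2 + 2 * b * x * x' + c * x'\<^sup>2)"
      by (simp add: power2_eq_square algebra_simps)
    finally show ?thesis
      using False * by (simp add: zero_le_mult_iff)
  qed
  have "0 \<le> Re (cinner v (?M *v v))" for v
    using add_mono[OF real[of "Re (v $ False)" "Re (v $ True)"] real[of "Im (v $ False)" "Im (v $ True)"]]
    by (simp add: cinner_def matrix_vector_mult_def mat2_def UNIV_bool power2_eq_square algebra_simps)
  then show "psd ?M"
    by (auto simp: psd_def dagger_def mat2_def vec_eq_iff)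
qed

section \<open>Density operators\<close>

lemma expval_mat_1: "density_op \<rho> \<Longrightarrow> expval \<rho> (mat 1) = 1"
  by (simp add: expval_def density_op_def)

lemma expval_mono:
  assumes "density_op \<rho>" "A \<preceq> B"
  shows "expval \<rho> A \<le> expval \<rho> B"
proof -
  have "0 \<le> expval \<rho> (B - A)"
    using assms by (simp add: expval_def density_op_def loewner_le_def trace_psd_mult_nonneg)
  then show ?thesis
    by (simp add: linear_diff[OF linear_expval])
qed

lemma trace_ketbra: "trace (ketbra v) = of_real ((norm v)\<^sup>2)"
  using trace_ketbra_mult[of v "mat 1"] by (simp add: cinner_self)

lemma density_op_ketbra: "norm v = 1 \<Longrightarrow> density_op (ketbra v)"
  by (simp add: density_op_def psd_ketbra trace_ketbra)

text \<open>Pure states probe the quadratic form on unit vectors, and homogeneity extends this to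
  all vectors.\<close>

lemma loewner_leI:
  assumes "dagger A = A" "dagger B = B" "\<And>\<rho>. density_op \<rho> \<Longrightarrow> expval \<rho> A \<le> expval \<rho> B"
  shows "A \<preceq> B"
proof -
  have "0 \<le> Re (cinner v ((B - A) *v v))" for v
  proof (cases "v = 0")
    case False
    define w where "w = (1 / norm v) *\<^sub>R v"
    have v: "v = norm v *\<^sub>R w"
      using False by (simp add: w_def)
    have "norm w = 1"
      using False by (simp add: w_def)
    then have "0 \<le> expval (ketbra w) (B - A)"
      using assms(3)[OF density_op_ketbra] by (simp add: linear_diff[OF linear_expval])
    then have "0 \<le> Re (cinner w ((B - A) *v w))"
      by (simp add: expval_def trace_ketbra_mult)
    moreover have "cinner v ((B - A) *v v) = of_real ((norm v)\<^sup>2) * cinner w ((B - A) *v w)"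
    proof -
      have v': "v = of_real (norm v) *s w"
        using v by (simp add: vec_eq_iff scaleR_conv_of_real[where 'a = complex])
      show ?thesis
        by (subst (1 2) v')
           (simp add: vector_scalar_commute cinner_scale_left cinner_scale_right power2_eq_square)
    qed
    ultimately show ?thesis by simp
  qed (simp add: cinner_def)
  then show ?thesis
    using assms(1,2) by (simp add: loewner_le_def psd_def dagger_diff)
qed

text \<open>Linearity in the state follows from linearity in the operator, since cyclicity of the
  trace exchanges the two arguments.\<close>

lemma expval_combination:
  "expval (a *\<^sub>R \<rho> + b *\<^sub>R \<sigma>) A = a * expval \<rho> A + b * expval \<sigma> A"
proof -
  have "expval (a *\<^sub>R \<rho> + b *\<^sub>R \<sigma>) A = expval A (a *\<^sub>R \<rho> + b *\<^sub>R \<sigma>)"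
    unfolding expval_def by (subst trace_mul_sym) simp
  also have "\<dots> = a * expval A \<rho> + b * expval A \<sigma>"
    by (simp add: linear_add[OF linear_expval] linear_scale[OF linear_expval])
  also have "\<dots> = a * expval \<rho> A + b * expval \<sigma> A"
    unfolding expval_def by (subst (1 2) trace_mul_sym) simp
  finally show ?thesis .
qed

lemma density_op_convex:
  assumes "density_op \<rho>" "density_op \<sigma>" "0 \<le> l" "l \<le> 1"
  shows "density_op ((1 - l) *\<^sub>R \<rho> + l *\<^sub>R \<sigma>)"
proof -
  have "psd ((1 - l) *\<^sub>R \<rho>)" "psd (l *\<^sub>R \<sigma>)"
    using assms by (simp_all add: density_op_def psd_scaleR)
  then have "psd ((1 - l) *\<^sub>R \<rho> + l *\<^sub>R \<sigma>)"
    by (simp add: psd_def dagger_add matrix_vector_mult_add_rdistrib cinner_add_right)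
  moreover have "trace ((1 - l) *\<^sub>R \<rho> + l *\<^sub>R \<sigma>) = (1 - l) *\<^sub>R trace \<rho> + l *\<^sub>R trace \<sigma>"
    by (simp add: trace_def sum.distrib scaleR_sum_right)
  ultimately show ?thesis
    using assms(1,2) by (simp add: density_op_def flip: scaleR_left_distrib)
qed

section \<open>The one-shot estimator\<close>

lemma expval_pauli_combination:
  "expval \<rho> (\<Sum>u\<in>UNIV. \<Sum>b\<in>UNIV. c u b *\<^sub>R pauli_proj u b) =
    (\<Sum>u\<in>UNIV. \<Sum>b\<in>UNIV. c u b * expval \<rho> (pauli_proj u b))"
  by (simp add: linear_sum[OF linear_expval] linear_scale[OF linear_expval])

lemma expectation_shot:
  assumes "distribution q" "density_op \<rho>"
  shows "measure_pmf.expectation (shot_pmf q \<rho>) (\<lambda>(u, b). f u b) =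
    (\<Sum>u\<in>UNIV. \<Sum>b\<in>UNIV. q u * expval \<rho> (pauli_proj u b) * f u b)"
proof -
  have "pmf (shot_pmf q \<rho>) x = q (fst x) * expval \<rho> (pauli_proj (fst x) (snd x))" for x
    by (cases x) (simp add: pmf_shot[OF assms])
  then show ?thesis
    by (subst integral_measure_pmf_real[where A = UNIV])
       (simp_all add: sum.cartesian_product case_prod_unfold mult_ac)
qed

lemma expectation_one_shot:
  assumes "admissible Op q \<alpha>" "density_op \<rho>"
  shows "measure_pmf.expectation (shot_pmf q \<rho>) (one_shot \<alpha> q) = expval \<rho> Op"
proof -
  have "measure_pmf.expectation (shot_pmf q \<rho>) (one_shot \<alpha> q) =
      (\<Sum>u\<in>UNIV. \<Sum>b\<in>UNIV. q u * expval \<rho> (pauli_proj u b) * (\<alpha> u b / q u))"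
    using assms unfolding one_shot_def by (intro expectation_shot) (auto simp: admissible_def)
  \<comment> \<open>The factor \<open>q u\<close> cancels; where it is zero, admissibility makes
    \<open>\<alpha> u b\<close> zero as well.\<close>
  also have "\<dots> = (\<Sum>u\<in>UNIV. \<Sum>b\<in>UNIV. \<alpha> u b * expval \<rho> (pauli_proj u b))"
    using assms(1) by (intro sum.cong refl) (auto simp: admissible_def)
  also have "\<dots> = expval \<rho> Op"
    using assms(1) by (simp add: admissible_def decomposes_def flip: expval_pauli_combination)
  finally show ?thesis .
qed

lemma integrable_measure_pmf_finite_type:
  fixes f :: "'a::finite \<Rightarrow> real"
  shows "integrable (measure_pmf p) f"
  by (intro integrable_measure_pmf_finite) simp

text \<open>Exhibits the variance as a linear functional of the state minus the square of another
  one, hence as a concave function of the state.\<close>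

lemma variance_one_shot:
  assumes "admissible Op q \<alpha>" "density_op \<rho>"
  shows "measure_pmf.variance (shot_pmf q \<rho>) (one_shot \<alpha> q) =
    expval \<rho> (\<Sum>u\<in>UNIV. \<Sum>b\<in>UNIV. ((\<alpha> u b)\<^sup>2 / q u) *\<^sub>R pauli_proj u b) - (expval \<rho> Op)\<^sup>2"
proof -
  have "measure_pmf.expectation (shot_pmf q \<rho>) (\<lambda>x. (one_shot \<alpha> q x)\<^sup>2) =
      measure_pmf.expectation (shot_pmf q \<rho>) (\<lambda>(u, b). (\<alpha> u b / q u)\<^sup>2)"
    by (simp add: one_shot_def case_prod_unfold)
  also have "\<dots> = (\<Sum>u\<in>UNIV. \<Sum>b\<in>UNIV. q u * expval \<rho> (pauli_proj u b) * (\<alpha> u b / q u)\<^sup>2)"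
    using assms by (intro expectation_shot) (auto simp: admissible_def)
  also have "\<dots> = (\<Sum>u\<in>UNIV. \<Sum>b\<in>UNIV. (\<alpha> u b)\<^sup>2 / q u * expval \<rho> (pauli_proj u b))"
  proof (intro sum.cong refl)
    show "q u * expval \<rho> (pauli_proj u b) * (\<alpha> u b / q u)\<^sup>2
        = (\<alpha> u b)\<^sup>2 / q u * expval \<rho> (pauli_proj u b)" for u b
      \<comment> \<open>For \<open>q u = 0\<close> both sides vanish, because division by zero gives
        zero.\<close>
      by (cases "q u = 0") (simp_all add: power2_eq_square)
  qed
  also have "\<dots> = expval \<rho> (\<Sum>u\<in>UNIV. \<Sum>b\<in>UNIV. ((\<alpha> u b)\<^sup>2 / q u) *\<^sub>R pauli_proj u b)"
    by (rule expval_pauli_combination[symmetric])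
  finally show ?thesis
    by (subst measure_pmf.variance_eq)
       (simp_all add: integrable_measure_pmf_finite_type expectation_one_shot[OF assms])
qed

section \<open>Averages of independent samples\<close>

lemma expectation_Pi_pmf_component:
  fixes g :: "'b \<Rightarrow> real"
  assumes "finite I" "i \<in> I"
  shows "measure_pmf.expectation (Pi_pmf I d (\<lambda>_. p)) (\<lambda>\<omega>. g (\<omega> i)) = measure_pmf.expectation p g"
proof -
  have "measure_pmf.expectation p g =
      measure_pmf.expectation (map_pmf (\<lambda>\<omega>. \<omega> i) (Pi_pmf I d (\<lambda>_. p))) g"
    using assms by (simp add: Pi_pmf_component)
  then show ?thesis by simp
qed

text \<open>After expanding the square, independence and the zero mean kill the cross terms, and
  each diagonal term contributes the same second moment.\<close>

lemma expectation_Pi_pmf_square_sum: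
  fixes g :: "'b::finite \<Rightarrow> real"
  assumes "finite I" "measure_pmf.expectation p g = 0"
  shows "measure_pmf.expectation (Pi_pmf I d (\<lambda>_. p)) (\<lambda>\<omega>. (\<Sum>i\<in>I. g (\<omega> i))\<^sup>2) =
    real (card I) * measure_pmf.expectation p (\<lambda>x. (g x)\<^sup>2)"
proof -
  let ?P = "Pi_pmf I d (\<lambda>_. p)"
  \<comment> \<open>Finite support makes every real function integrable, which settles all
    integrability conditions below.\<close>
  have "finite (set_pmf ?P)"
    using assms(1) by (subst set_Pi_pmf) auto
  then have int: "integrable ?P f" for f :: "('a \<Rightarrow> 'b) \<Rightarrow> real"
    by (rule integrable_measure_pmf_finite)
  have cross: "measure_pmf.expectation ?P (\<lambda>\<omega>. g (\<omega> i) * g (\<omega> j)) =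
      (if i = j then measure_pmf.expectation p (\<lambda>x. (g x)\<^sup>2) else 0)" if "i \<in> I" "j \<in> I" for i j
  proof (cases "i = j")
    case True
    then show ?thesis
      using expectation_Pi_pmf_component[OF assms(1) that(1), of d p "\<lambda>x. (g x)\<^sup>2"]
      by (simp add: power2_eq_square)
  next
    case False
    have "prob_space.indep_vars (measure_pmf ?P) (\<lambda>_. borel) (\<lambda>x \<omega>. g (\<omega> x)) I"
      by (rule prob_space.indep_vars_compose2[OF measure_pmf.prob_space_axioms
          indep_vars_Pi_pmf[OF assms(1)]]) simp
    then have "prob_space.indep_vars (measure_pmf ?P) (\<lambda>_. borel) (\<lambda>x \<omega>. g (\<omega> x)) {i, j}"
      by (rule prob_space.indep_vars_subset[OF measure_pmf.prob_space_axioms]) (use that in auto)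
    from prob_space.indep_vars_lebesgue_integral[OF measure_pmf.prob_space_axioms _ this int]
    have "measure_pmf.expectation ?P (\<lambda>\<omega>. g (\<omega> i) * g (\<omega> j)) =
        measure_pmf.expectation ?P (\<lambda>\<omega>. g (\<omega> i)) * measure_pmf.expectation ?P (\<lambda>\<omega>. g (\<omega> j))"
      using False by simp
    then show ?thesis
      using False that assms by (simp add: expectation_Pi_pmf_component)
  qed
  have "measure_pmf.expectation ?P (\<lambda>\<omega>. (\<Sum>i\<in>I. g (\<omega> i))\<^sup>2) =
      (\<Sum>i\<in>I. \<Sum>j\<in>I. measure_pmf.expectation ?P (\<lambda>\<omega>. g (\<omega> i) * g (\<omega> j)))"
    by (simp add: power2_eq_square sum_product int)
  also have "\<dots> = (\<Sum>i\<in>I. \<Sum>j\<in>I. if i = j then measure_pmf.expectation p (\<lambda>x. (g x)\<^sup>2) else 0)"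
    by (intro sum.cong refl) (simp only: cross)
  finally show ?thesis
    using assms(1) by simp
qed

lemma expectation_fidelity_estimate:
  assumes "admissible Op q \<alpha>" "density_op \<rho>" "N \<ge> 1"
  shows "measure_pmf.expectation (online_pmf N q \<rho>) (fidelity_estimate N \<alpha> q) = expval \<rho> Op"
proof -
  let ?P = "Pi_pmf {..<N} undefined (\<lambda>_. shot_pmf q \<rho>)"
  have "finite (set_pmf ?P)"
    by (subst set_Pi_pmf) auto
  then have int: "integrable ?P f" for f :: "(nat \<Rightarrow> _) \<Rightarrow> real"
    by (rule integrable_measure_pmf_finite)
  have "measure_pmf.expectation ?P (\<lambda>\<omega>. \<Sum>j<N. one_shot \<alpha> q (\<omega> j)) = (\<Sum>j<N. expval \<rho> Op)"
    using assms by (simp add: int expectation_Pi_pmf_component expectation_one_shot)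
  then show ?thesis
    using assms(3) by (simp add: online_pmf_def fidelity_estimate_def[abs_def])
qed

text \<open>The error is the average of centred shots; their squared sum has \<open>N\<close>
  surviving terms, against a factor \<open>N\<^sup>2\<close> in the denominator.\<close>

lemma mse_fidelity_estimate:
  assumes "admissible Op q \<alpha>" "density_op \<rho>" "N \<ge> 1"
  shows "measure_pmf.expectation (online_pmf N q \<rho>)
      (\<lambda>\<omega>. (fidelity_estimate N \<alpha> q \<omega> - expval \<rho> Op)\<^sup>2) =
    measure_pmf.variance (shot_pmf q \<rho>) (one_shot \<alpha> q) / real N"
proof -
  let ?p = "shot_pmf q \<rho>"
  define g where "g x = one_shot \<alpha> q x - expval \<rho> Op" for x
  have "measure_pmf.expectation ?p g = 0"
    by (simp add: g_def[abs_def] integrable_measure_pmf_finite_type expectation_one_shot[OF assms(1,2)])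
  note sq = expectation_Pi_pmf_square_sum[OF finite_lessThan[of N] this, of undefined]
  have "fidelity_estimate N \<alpha> q \<omega> - expval \<rho> Op = (\<Sum>j<N. g (\<omega> j)) / real N" for \<omega>
    using assms(3) by (simp add: fidelity_estimate_def g_def sum_subtractf field_simps)
  then have "measure_pmf.expectation (online_pmf N q \<rho>)
      (\<lambda>\<omega>. (fidelity_estimate N \<alpha> q \<omega> - expval \<rho> Op)\<^sup>2) =
    measure_pmf.expectation (online_pmf N q \<rho>) (\<lambda>\<omega>. (\<Sum>j<N. g (\<omega> j))\<^sup>2) / (real N)\<^sup>2"
    by (simp add: power_divide)
  also have "\<dots> = measure_pmf.expectation ?p (\<lambda>x. (g x)\<^sup>2) / real N"
    using assms(3) sq by (simp add: online_pmf_def power2_eq_square)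
  also have "\<dots> = measure_pmf.variance ?p (one_shot \<alpha> q) / real N"
    by (simp add: g_def expectation_one_shot[OF assms(1,2)])
  finally show ?thesis .
qed

section \<open>The semidefinite program\<close>

text \<open>The determinant of the 2x2 block forces \<open>\<alpha> u b\<close> to vanish together
  with \<open>q u\<close>.\<close>

lemma sdp_feasible_admissible:
  assumes "sdp_feasible Op \<alpha> q y t \<gamma> s"
  shows "admissible Op q \<alpha>"
proof -
  have "(\<alpha> u b)\<^sup>2 \<le> y u b * q u" for u b
    using assms by (simp add: sdp_feasible_def psd_mat2_iff)
  then have "\<alpha> u b = 0" if "q u = 0" for u b
    using that by (metis mult_zero_right power2_less_eq_zero_iff)
  then show ?thesis
    using assms by (simp add: sdp_feasible_def admissible_def)
qed

text \<open>Completing the square in \<open>F = expval \<rho> Op\<close>: \<open>2 * t * F - F\<^sup>2 \<le> t\<^sup>2 \<le> s\<close>.\<close>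

lemma sdp_feasible_variance_le:
  assumes "sdp_feasible Op \<alpha> q y t \<gamma> s" "density_op \<rho>"
  shows "measure_pmf.variance (shot_pmf q \<rho>) (one_shot \<alpha> q) \<le> \<gamma> + s"
proof -
  let ?Y = "\<Sum>u\<in>UNIV. \<Sum>b\<in>UNIV. y u b *\<^sub>R pauli_proj u b"
  have y: "0 \<le> y u b" "0 \<le> q u" "(\<alpha> u b)\<^sup>2 \<le> y u b * q u" for u b
    using assms(1) by (auto simp: sdp_feasible_def psd_mat2_iff)
  \<comment> \<open>For \<open>q u = 0\<close> the quotient is zero and the claim is just
    \<open>0 \<le> y u b\<close>.\<close>
  have "(\<alpha> u b)\<^sup>2 / q u \<le> y u b" for u b
    using y(1)[of u b] y(2)[of u] y(3)[of u b] by (cases "q u = 0") (simp_all add: divide_le_eq)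
  then have "expval \<rho> (\<Sum>u\<in>UNIV. \<Sum>b\<in>UNIV. ((\<alpha> u b)\<^sup>2 / q u) *\<^sub>R pauli_proj u b) \<le> expval \<rho> ?Y"
    unfolding expval_pauli_combination
    by (intro sum_mono mult_right_mono expval_pauli_proj_nonneg assms(2))
  moreover have "expval \<rho> (?Y - (2 * t) *\<^sub>R Op) \<le> expval \<rho> (\<gamma> *\<^sub>R mat 1)"
    using assms by (intro expval_mono) (simp_all add: sdp_feasible_def)
  then have "expval \<rho> ?Y - 2 * t * expval \<rho> Op \<le> \<gamma>"
    using assms(2)
    by (simp add: linear_diff[OF linear_expval] linear_scale[OF linear_expval] expval_mat_1)
  moreover have "t\<^sup>2 \<le> s"
    using assms(1) psd_mat2_iff[of s t 1] by (simp add: sdp_feasible_def)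
  moreover have "2 * t * expval \<rho> Op - (expval \<rho> Op)\<^sup>2 \<le> t\<^sup>2"
    using zero_le_power2[of "t - expval \<rho> Op"] by (simp add: power2_diff)
  ultimately show ?thesis
    unfolding variance_one_shot[OF sdp_feasible_admissible[OF assms(1)] assms(2)] by linarith
qed

text \<open>\<open>y = \<alpha>\<^sup>2 / q\<close> and \<open>s = t\<^sup>2\<close> are the
  smallest values the 2x2 blocks permit, so only the operator inequality remains, and it can be
  tested on states.\<close>

lemma sdp_feasible_of_admissible:
  assumes "admissible Op q \<alpha>"
    and "\<And>\<rho>. density_op \<rho> \<Longrightarrow>
      expval \<rho> (\<Sum>u\<in>UNIV. \<Sum>b\<in>UNIV. ((\<alpha> u b)\<^sup>2 / q u) *\<^sub>R pauli_proj u b)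
        - 2 * t * expval \<rho> Op \<le> \<gamma>"
  shows "sdp_feasible Op \<alpha> q (\<lambda>u b. (\<alpha> u b)\<^sup>2 / q u) t \<gamma> (t\<^sup>2)"
proof -
  let ?Y = "\<Sum>u\<in>UNIV. \<Sum>b\<in>UNIV. ((\<alpha> u b)\<^sup>2 / q u) *\<^sub>R pauli_proj u b"
  have Op: "(\<Sum>u\<in>UNIV. \<Sum>b\<in>UNIV. \<alpha> u b *\<^sub>R pauli_proj u b) = Op"
    using assms(1) by (simp add: admissible_def decomposes_def)
  have "?Y - (2 * t) *\<^sub>R Op \<preceq> \<gamma> *\<^sub>R mat 1"
  proof (rule loewner_leI)
    show "dagger (?Y - (2 * t) *\<^sub>R Op) = ?Y - (2 * t) *\<^sub>R Op"
      \<comment> \<open>\<open>Op\<close> is Hermitian as a real combination of the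
        projections.\<close>
      unfolding Op[symmetric] by (simp add: dagger_diff dagger_scaleR dagger_sum dagger_pauli_proj)
    show "dagger (\<gamma> *\<^sub>R mat 1) = \<gamma> *\<^sub>R mat 1"
      by (simp add: dagger_scaleR)
    show "expval \<rho> (?Y - (2 * t) *\<^sub>R Op) \<le> expval \<rho> (\<gamma> *\<^sub>R mat 1)" if "density_op \<rho>" for \<rho>
      using assms(2)[OF that] that
      by (simp add: linear_diff[OF linear_expval] linear_scale[OF linear_expval] expval_mat_1)
  qed
  moreover have "psd (mat2 (of_real ((\<alpha> u b)\<^sup>2 / q u)) (of_real (\<alpha> u b)) (of_real (\<alpha> u b)) (of_real (q u)))"
    for u b
    using assms(1) unfolding psd_mat2_iff
    by (cases "q u = 0") (auto simp: admissible_def distribution_def)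
  moreover have "psd (mat2 (of_real (t\<^sup>2)) (of_real t) (of_real t) 1)"
    using psd_mat2_iff[of "t\<^sup>2" t 1] by simp
  ultimately show ?thesis
    using assms(1) by (simp add: sdp_feasible_def admissible_def)
qed

text \<open>Outcome probabilities lie in [0,1], so the sum of the absolute coefficients serves for
  all states. This uniformity makes the second-order error below vanish with the step size.\<close>

lemma expval_bounded:
  assumes "decomposes Op \<alpha>"
  obtains C where "\<And>\<rho>. density_op \<rho> \<Longrightarrow> \<bar>expval \<rho> Op\<bar> \<le> C"
proof
  fix \<rho> :: "'a oper" assume \<rho>: "density_op \<rho>"
  have P: "0 \<le> expval \<rho> (pauli_proj u b)" "expval \<rho> (pauli_proj u b) \<le> 1" for u b
  proof -
    show "0 \<le> expval \<rho> (pauli_proj u b)" for b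
      using \<rho> by (rule expval_pauli_proj_nonneg)
    then have "expval \<rho> (pauli_proj u b) \<le> (\<Sum>b\<in>UNIV. expval \<rho> (pauli_proj u b))"
      by (intro member_le_sum) auto
    then show "expval \<rho> (pauli_proj u b) \<le> 1"
      using expval_pauli_proj_sum[OF \<rho>] by simp
  qed
  have "\<bar>expval \<rho> Op\<bar> = \<bar>\<Sum>u\<in>UNIV. \<Sum>b\<in>UNIV. \<alpha> u b * expval \<rho> (pauli_proj u b)\<bar>"
    using assms by (simp add: decomposes_def flip: expval_pauli_combination)
  also have "\<dots> \<le> (\<Sum>u\<in>UNIV. \<Sum>b\<in>UNIV. \<bar>\<alpha> u b\<bar>)"
    using P by (intro order.trans[OF sum_abs] sum_mono) (simp add: abs_mult mult_left_le)
  finally show "\<bar>expval \<rho> Op\<bar> \<le> (\<Sum>u\<in>UNIV. \<Sum>b\<in>UNIV. \<bar>\<alpha> u b\<bar>)" .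
qed

text \<open>Near-maximality of \<open>\<rho>\<close> is tested on the segment from \<open>\<rho>\<close> to \<open>\<sigma>\<close> at distance \<open>\<delta>\<close>; this
  bounds the directional derivative of the concave functional at \<open>\<rho>\<close>.\<close>

lemma variance_functional_linearization:
  assumes V: "\<And>\<rho>. density_op \<rho> \<Longrightarrow> expval \<rho> M - (expval \<rho> Op)\<^sup>2 \<le> V"
    and C: "\<And>\<rho>. density_op \<rho> \<Longrightarrow> \<bar>expval \<rho> Op\<bar> \<le> C"
    and \<rho>: "density_op \<rho>" "V - \<delta>\<^sup>2 \<le> expval \<rho> M - (expval \<rho> Op)\<^sup>2"
    and \<sigma>: "density_op \<sigma>"
    and \<delta>: "0 < \<delta>" "\<delta> \<le> 1"
  shows "expval \<sigma> M - 2 * expval \<rho> Op * expval \<sigma> Op + (expval \<rho> Op)\<^sup>2 \<le> V + (1 + 4 * C\<^sup>2) * \<delta>"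
proof -
  define m f m' f' where "m = expval \<rho> M" and "f = expval \<rho> Op"
    and "m' = expval \<sigma> M" and "f' = expval \<sigma> Op"
  have "density_op ((1 - \<delta>) *\<^sub>R \<rho> + \<delta> *\<^sub>R \<sigma>)"
    using \<rho>(1) \<sigma> \<delta> by (intro density_op_convex) auto
  from V[OF this] have "(1 - \<delta>) * m + \<delta> * m' - ((1 - \<delta>) * f + \<delta> * f')\<^sup>2 \<le> V"
    by (simp add: expval_combination m_def f_def m'_def f'_def)
  \<comment> \<open>Exact expansion along the segment: value at \<rho>, first-order term, and a
    quadratic remainder.\<close>
  also have "(1 - \<delta>) * m + \<delta> * m' - ((1 - \<delta>) * f + \<delta> * f')\<^sup>2 =
      (m - f\<^sup>2) + \<delta> * (m' - 2 * f * f' + f\<^sup>2 - (m - f\<^sup>2)) - \<delta>\<^sup>2 * (f' - f)\<^sup>2"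
    by (simp add: power2_eq_square algebra_simps)
  finally have "\<delta> * (m' - 2 * f * f' + f\<^sup>2 - (m - f\<^sup>2)) \<le> V - (m - f\<^sup>2) + \<delta>\<^sup>2 * (f' - f)\<^sup>2"
    by simp
  \<comment> \<open>The optimality gap is chosen of order \<open>\<delta>\<^sup>2\<close>, so that
    an error of order \<open>\<delta>\<close> is left after dividing by
    \<open>\<delta>\<close>.\<close>
  also have "\<dots> \<le> \<delta>\<^sup>2 + \<delta>\<^sup>2 * (2 * C)\<^sup>2"
  proof (intro add_mono mult_left_mono)
    show "V - (m - f\<^sup>2) \<le> \<delta>\<^sup>2"
      using \<rho>(2) by (simp add: m_def f_def)
    have "\<bar>f' - f\<bar> \<le> 2 * C"
      using C[OF \<rho>(1)] C[OF \<sigma>] by (simp add: f_def f'_def)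
    then show "(f' - f)\<^sup>2 \<le> (2 * C)\<^sup>2"
      by (metis abs_ge_zero power2_abs power_mono)
  qed simp
  also have "\<dots> = \<delta> * ((1 + 4 * C\<^sup>2) * \<delta>)"
    by (simp add: power2_eq_square algebra_simps)
  finally have "m' - 2 * f * f' + f\<^sup>2 - (m - f\<^sup>2) \<le> (1 + 4 * C\<^sup>2) * \<delta>"
    using \<delta>(1) by simp
  moreover have "m - f\<^sup>2 \<le> V"
    using V[OF \<rho>(1)] by (simp add: m_def f_def)
  ultimately show ?thesis
    by (simp add: m_def f_def m'_def f'_def)
qed

text \<open>For each admissible pair with finite worst-case variance \<open>V\<close>, a nearly
  worst state yields a feasible point with objective \<open>V\<close> plus a multiple of
  \<open>\<delta>\<close>; then \<open>\<delta>\<close> tends to zero. The state \<tau> makes the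
  supremum range over a nonempty set.\<close>

lemma sdp_optimal_le_minimax_var:
  fixes Op \<tau> :: "'n::finite oper"
  assumes opt: "sdp_optimal Op \<alpha> q y t \<gamma> s"
    and \<tau>: "density_op \<tau>"
  shows "ereal (\<gamma> + s) \<le> minimax_var Op"
  unfolding minimax_var_def
proof (rule INF_greatest, clarify)
  fix q' \<alpha>' assume adm: "admissible Op q' \<alpha>'"
  let ?var = "\<lambda>\<rho>. measure_pmf.variance (shot_pmf q' \<rho>) (one_shot \<alpha>' q')"
  let ?S = "SUP \<rho>\<in>Collect density_op. ereal (?var \<rho>)"
  let ?M = "\<Sum>u\<in>UNIV. \<Sum>b\<in>UNIV. ((\<alpha>' u b)\<^sup>2 / q' u) *\<^sub>R pauli_proj u b"
  have "ereal (?var \<tau>) \<le> ?S"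
    using \<tau> by (intro SUP_upper) simp
  then have "?S \<noteq> -\<infinity>" by auto
  show "ereal (\<gamma> + s) \<le> ?S"
  proof (cases ?S)
    case (real V)
    have V: "?var \<rho> \<le> V" if "density_op \<rho>" for \<rho>
    proof -
      have "ereal (?var \<rho>) \<le> ?S"
        using that by (intro SUP_upper) simp
      then show ?thesis by (simp add: real)
    qed
    obtain C where C: "\<And>\<rho>. density_op \<rho> \<Longrightarrow> \<bar>expval \<rho> Op\<bar> \<le> C"
      using adm expval_bounded unfolding admissible_def by blast
    have step: "\<gamma> + s \<le> V + (1 + 4 * C\<^sup>2) * \<delta>" if \<delta>: "0 < \<delta>" "\<delta> \<le> 1" for \<delta>
    proof -
      have "ereal (V - \<delta>\<^sup>2) < ?S"
        using \<delta> by (simp add: real)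
      then obtain \<rho> where \<rho>: "density_op \<rho>" "V - \<delta>\<^sup>2 < ?var \<rho>"
        unfolding less_SUP_iff by auto
      define t' where "t' = expval \<rho> Op"
      \<comment> \<open>The right-hand side serves as the new \<open>\<gamma>\<close>; its
        \<open>- t'\<^sup>2\<close> cancels against \<open>s = t'\<^sup>2\<close> in the
        objective.\<close>
      have "expval \<sigma> ?M - 2 * t' * expval \<sigma> Op \<le> V + (1 + 4 * C\<^sup>2) * \<delta> - t'\<^sup>2"
        if "density_op \<sigma>" for \<sigma>
        using variance_functional_linearization[of ?M Op V C \<rho> \<delta> \<sigma>] V C \<rho> \<delta> that
        by (simp add: variance_one_shot[OF adm] t'_def)
      from opt[unfolded sdp_optimal_def, THEN conjunct2, rule_format,
          OF sdp_feasible_of_admissible[OF adm this]]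
      show ?thesis by simp
    qed
    have "((\<lambda>\<delta>. V + (1 + 4 * C\<^sup>2) * \<delta>) \<longlongrightarrow> V + (1 + 4 * C\<^sup>2) * 0) (at_right 0)"
      by (intro tendsto_intros)
    moreover have "eventually (\<lambda>\<delta>. \<gamma> + s \<le> V + (1 + 4 * C\<^sup>2) * \<delta>) (at_right 0)"
      using step by (auto simp: eventually_at_right[of 0 1] intro!: exI[of _ 1])
    ultimately have "\<gamma> + s \<le> V + (1 + 4 * C\<^sup>2) * 0"
      by (rule tendsto_lowerbound) simp
    then show ?thesis by (simp add: real)
  \<comment> \<open>An infinite supremum bounds everything, and minus infinity was excluded
    above.\<close>
  qed (use \<open>?S \<noteq> -\<infinity>\<close> in simp_all)
qed

theorem corollary1:
  fixes \<psi> :: "'n::finite state"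
    and N :: nat
    and \<alpha> y :: "'n setting \<Rightarrow> 'n bits \<Rightarrow> real"
    and q :: "'n setting \<Rightarrow> real"
    and t \<gamma> s :: real
  assumes "norm \<psi> = 1"
    and "N \<ge> 1"
    and "sdp_optimal (ketbra \<psi>) \<alpha> q y t \<gamma> s"
  shows "(\<forall>\<rho>. density_op \<rho> \<longrightarrow>
            measure_pmf.expectation (online_pmf N q \<rho>) (fidelity_estimate N \<alpha> q)
              = expval \<rho> (ketbra \<psi>)) \<and>
         (SUP \<rho> \<in> Collect density_op.
            ereal (measure_pmf.expectation (online_pmf N q \<rho>)
              (\<lambda>\<omega>. (fidelity_estimate N \<alpha> q \<omega> - expval \<rho> (ketbra \<psi>))\<^sup>2)))
           \<le> minimax_var (ketbra \<psi>) / ereal (real N)"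
proof (intro conjI allI impI SUP_least)
  have feas: "sdp_feasible (ketbra \<psi>) \<alpha> q y t \<gamma> s"
    using assms(3) by (simp add: sdp_optimal_def)
  note adm = sdp_feasible_admissible[OF feas]
  show "measure_pmf.expectation (online_pmf N q \<rho>) (fidelity_estimate N \<alpha> q) = expval \<rho> (ketbra \<psi>)"
    if "density_op \<rho>" for \<rho>
    using adm that assms(2) by (rule expectation_fidelity_estimate)
  fix \<rho> :: "'n oper" assume "\<rho> \<in> Collect density_op"
  then have \<rho>: "density_op \<rho>" by simp
  \<comment> \<open>The optimal value \<open>\<gamma> + s\<close> links the two sides: it bounds the
    one-shot variance at every state and is at most the minimax variance.\<close>
  have "ereal (measure_pmf.expectation (online_pmf N q \<rho>)
      (\<lambda>\<omega>. (fidelity_estimate N \<alpha> q \<omega> - expval \<rho> (ketbra \<psi>))\<^sup>2)) \<le> ereal (\<gamma> + s) / ereal (real N)"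
    unfolding mse_fidelity_estimate[OF adm \<rho> assms(2)]
    using sdp_feasible_variance_le[OF feas \<rho>] assms(2) by (simp add: divide_right_mono)
  also have "\<dots> \<le> minimax_var (ketbra \<psi>) / ereal (real N)"
    \<comment> \<open>The target state itself witnesses that a density operator exists.\<close>
    using sdp_optimal_le_minimax_var[OF assms(3) density_op_ketbra[OF assms(1)]] assms(2)
    by (intro ereal_divide_right_mono) simp_all
  finally show "ereal (measure_pmf.expectation (online_pmf N q \<rho>)
      (\<lambda>\<omega>. (fidelity_estimate N \<alpha> q \<omega> - expval \<rho> (ketbra \<psi>))\<^sup>2))
    \<le> minimax_var (ketbra \<psi>) / ereal (real N)" .
qed

end
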